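(* Let $a,b\ge1$ and $n\ge 0$ be integers, and let $e^{a,b}_n$ denote the number of edges of the Horadam cube $\Pi^{a,b}_n$. Then $$e^{a,b}_n=\sum_{k=0}^{n-1}s^{a,b}_k\left(s^{a,b}_{n-k}-s^{a,b}_{n-1-k}\right).$$
   Context: For integers $a,b\ge1$ and $n\ge 0$, $\mathcal S^{a,b}_n$ is the set of all strings of length $n$ over the alphabet $\{0,1,\dots,a+b-1\}$ in which every letter from $\{a,\dots,a+b-1\}$ appears only immediately after a letter $0$; $\mathcal S^{a,b}_0$ contains only the empty string. The Horadam cube $\Pi^{a,b}_n$ is the simple graph with vertex set $\mathcal S^{a,b}_n$ in which $x_1\cdots x_n$ and $y_1\cdots y_n$ are adjacent if and only if $\sum_{i=1}^n|x_i-y_i|=1$. $s^{a,b}_n=|\mathcal S^{a,b}_n|$ is its number of vertices; equivalently $s^{a,b}_0=1$, $s^{a,b}_1=a$ and $s^{a,b}_n=as^{a,b}_{n-1}+bs^{a,b}_{n-2}$ for $n\ge2$. *)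

theory Defs
  imports Main
begin

definition horadam_strings :: "nat \<Rightarrow> nat \<Rightarrow> nat \<Rightarrow> nat list set" where
  "horadam_strings a b n =
     {x. length x = n \<and> set x \<subseteq> {0..<a + b} \<and>
         (\<forall>i<n. a \<le> x ! i \<longrightarrow> 0 < i \<and> x ! (i - 1) = 0)}"

definition horadam_adj :: "nat \<Rightarrow> nat \<Rightarrow> nat \<Rightarrow> nat list \<Rightarrow> nat list \<Rightarrow> bool" where
  "horadam_adj a b n x y \<longleftrightarrow>
     x \<in> horadam_strings a b n \<and> y \<in> horadam_strings a b n \<and>
     (\<Sum>i<n. \<bar>int (x ! i) - int (y ! i)\<bar>) = 1"

text \<open>The edges of the Horadam cube are unordered pairs of adjacent vertices; adjacency is
  symmetric and irreflexive, so the cube is a simple graph.\<close>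

definition horadam_edges :: "nat \<Rightarrow> nat \<Rightarrow> nat \<Rightarrow> nat list set set" where
  "horadam_edges a b n = {{x, y} | x y. horadam_adj a b n x y}"

definition horadam_s :: "nat \<Rightarrow> nat \<Rightarrow> nat \<Rightarrow> nat" where
  "horadam_s a b n = card (horadam_strings a b n)"

definition horadam_e :: "nat \<Rightarrow> nat \<Rightarrow> nat \<Rightarrow> nat" where
  "horadam_e a b n = card (horadam_edges a b n)"

lemma finite_horadam_strings: "finite (horadam_strings a b n)"
  by (rule finite_subset[OF _ finite_lists_length_eq[of "{0..<a + b}" n]])
    (auto simp: horadam_strings_def)

lemma finite_horadam_edges: "finite (horadam_edges a b n)"
  by (rule finite_subset[of _ "Pow (horadam_strings a b n)"])
    (auto simp: horadam_edges_def horadam_adj_def finite_horadam_strings)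

lemma horadam_adj_sym: "horadam_adj a b n x y \<Longrightarrow> horadam_adj a b n y x"
  by (simp add: horadam_adj_def abs_minus_commute)

lemma horadam_adj_irrefl: "\<not> horadam_adj a b n x x"
  by (simp add: horadam_adj_def)

end

(* Lowering a nonzero letter by 1 never leaves the set of admissible strings, so the edges
   correspond to the pairs of a string and a position holding a nonzero letter. Cutting the
   string just after that position leaves two independent admissible strings, the first of which
   ends in a nonzero letter; the strings ending in 0 are those of length one less with 0
   appended, which explains the differences s_(i+1) - s_i. *)

theory Submission
  imports Defs
begin

text \<open>Letters only get smaller, so a letter that is at least \<open>a\<close> afterwards was
  so before and follows a 0 in \<open>y\<close>. Position \<open>i\<close> holds a nonzero letter,
  so that 0 lies elsewhere and survives the update.\<close>

lemma horadam_strings_decrement: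
  assumes y: "y \<in> horadam_strings a b n" and i: "i < n" and nz: "y ! i \<noteq> 0"
  shows "y[i := y ! i - 1] \<in> horadam_strings a b n"
proof -
  have len: "length y = n" and sub: "set y \<subseteq> {0..<a + b}"
    and ok: "\<And>j. j < n \<Longrightarrow> a \<le> y ! j \<Longrightarrow> 0 < j \<and> y ! (j - 1) = 0"
    using y by (auto simp: horadam_strings_def)
  have "y ! i \<in> set y" using len i by simp
  then have "y ! i - 1 \<in> {0..<a + b}" using sub by fastforce
  then have "set (y[i := y ! i - 1]) \<subseteq> {0..<a + b}"
    using sub set_update_subset_insert[of y i "y ! i - 1"] by blast
  moreover have "0 < j \<and> y[i := y ! i - 1] ! (j - 1) = 0"
    if j: "j < n" "a \<le> y[i := y ! i - 1] ! j" for j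
  proof -
    have "a \<le> y ! j" using j len i by (cases "j = i") auto
    then have "0 < j" "y ! (j - 1) = 0" using ok j by auto
    then show ?thesis using len nz by (cases "j - 1 = i") auto
  qed
  ultimately show ?thesis using len by (auto simp: horadam_strings_def)
qed

lemma horadam_adj_decrement:
  assumes "y \<in> horadam_strings a b n" "i < n" "y ! i \<noteq> 0"
  shows "horadam_adj a b n y (y[i := y ! i - 1])"
proof -
  have len: "length y = n" using assms by (simp add: horadam_strings_def)
  \<comment> \<open>As \<open>y ! i\<close> is nonzero, the natural subtraction is not truncated,
    and term \<open>i\<close> is exactly 1.\<close>
  have "(\<Sum>j<n. \<bar>int (y ! j) - int (y[i := y ! i - 1] ! j)\<bar>) = (\<Sum>j<n. if j = i then 1 else 0)"
    using assms len by (intro sum.cong) (auto simp: nth_list_update of_nat_diff)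
  also have "\<dots> = 1" using assms by simp
  finally show ?thesis
    using assms horadam_strings_decrement by (auto simp: horadam_adj_def)
qed

text \<open>A sum of naturals equals 1 only if one term is 1 and all others are 0. The two cases
  record which endpoint carries the larger letter there.\<close>

lemma horadam_adj_imp_decrement:
  assumes "horadam_adj a b n x y"
  obtains i where "i < n" "y ! i \<noteq> 0" "x = y[i := y ! i - 1]"
  | i where "i < n" "x ! i \<noteq> 0" "y = x[i := x ! i - 1]"
proof -
  have len: "length x = n" "length y = n"
    using assms by (auto simp: horadam_adj_def horadam_strings_def)
  \<comment> \<open>The sum is moved from integers to naturals, where \<open>sum_eq_1_iff\<close>
    applies.\<close>
  have "int (\<Sum>i<n. nat \<bar>int (x ! i) - int (y ! i)\<bar>) = 1"
    using assms by (simp add: horadam_adj_def)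
  then have "(\<Sum>i<n. nat \<bar>int (x ! i) - int (y ! i)\<bar>) = 1" by linarith
  then obtain i where i: "i < n" "nat \<bar>int (x ! i) - int (y ! i)\<bar> = 1"
    and "\<forall>j\<in>{..<n}. i \<noteq> j \<longrightarrow> nat \<bar>int (x ! j) - int (y ! j)\<bar> = 0"
    by (subst (asm) sum_eq_1_iff) blast+
  then have eq: "x ! j = y ! j" if "j < n" "j \<noteq> i" for j
    using that by force
  consider "y ! i = Suc (x ! i)" | "x ! i = Suc (y ! i)" using i by linarith
  then show thesis
  proof cases
    case 1
    then have "x = y[i := y ! i - 1]"
      using len eq i by (auto intro!: nth_equalityI simp: nth_list_update)
    with 1 i that(1) show thesis by simp
  next
    case 2
    then have "y = x[i := x ! i - 1]"
      using len eq i by (auto intro!: nth_equalityI simp: nth_list_update)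
    with 2 i that(2) show thesis by simp
  qed
qed

text \<open>The letter sum orients each edge: it tells the upper endpoint from the lowered one in
  the injectivity argument below.\<close>

lemma sum_list_decrement:
  fixes y :: "nat list"
  assumes "i < length y" "y ! i \<noteq> 0"
  shows "sum_list y = Suc (sum_list (y[i := y ! i - 1]))"
  using assms member_le_sum_list[of "y ! i" y] by (simp add: sum_list_update)

text \<open>Each edge is encoded by its upper endpoint and the position to be lowered; this encoding
  is a bijection onto the edges.\<close>

lemma horadam_e_eq_sum_nonzero:
  "horadam_e a b n = (\<Sum>i<n. card {y \<in> horadam_strings a b n. y ! i \<noteq> 0})"
proof -
  let ?P = "SIGMA i:{..<n}. {y \<in> horadam_strings a b n. y ! i \<noteq> 0}"
  let ?f = "\<lambda>(i, y). {y, y[i := y ! i - 1]}"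
  have "horadam_edges a b n = ?f ` ?P"
  proof (intro equalityI subsetI)
    fix e assume "e \<in> horadam_edges a b n"
    then obtain x y where e: "e = {x, y}" and adj: "horadam_adj a b n x y"
      by (auto simp: horadam_edges_def)
    have xy: "x \<in> horadam_strings a b n" "y \<in> horadam_strings a b n"
      using adj by (auto simp: horadam_adj_def)
    from adj show "e \<in> ?f ` ?P"
    proof (cases rule: horadam_adj_imp_decrement)
      case (1 i)
      then have "e = ?f (i, y)" "(i, y) \<in> ?P" using e xy by auto
      then show ?thesis by blast
    next
      case (2 i)
      then have "e = ?f (i, x)" "(i, x) \<in> ?P" using e xy by auto
      then show ?thesis by blast
    qed
  next
    fix e assume "e \<in> ?f ` ?P"
    then obtain i y where "e = {y, y[i := y ! i - 1]}"
      and "i < n" "y \<in> horadam_strings a b n" "y ! i \<noteq> 0" by auto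
    then show "e \<in> horadam_edges a b n"
      unfolding horadam_edges_def using horadam_adj_decrement by blast
  qed
  moreover have "inj_on ?f ?P"
  proof (rule inj_onI, clarsimp)
    fix i y j z
    assume iy: "i < n" "y \<in> horadam_strings a b n" "0 < y ! i"
      and jz: "j < n" "z \<in> horadam_strings a b n" "0 < z ! j"
      and eq: "{y, y[i := y ! i - Suc 0]} = {z, z[j := z ! j - Suc 0]}"
    have len: "length y = n" "length z = n" using iy jz by (auto simp: horadam_strings_def)
    have "sum_list y = Suc (sum_list (y[i := y ! i - 1]))"
      "sum_list z = Suc (sum_list (z[j := z ! j - 1]))"
      using sum_list_decrement iy jz len by auto
    \<comment> \<open>The crosswise matching of the two pairs would make each of the two letter sums
      exceed the other by 1.\<close>
    with eq have yz: "y = z" and upd: "y[i := y ! i - 1] = z[j := z ! j - 1]"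
      by (auto simp: doubleton_eq_iff)
    have "i = j"
    proof (rule ccontr)
      assume "i \<noteq> j"
      \<comment> \<open>Compare the two updated strings at \<open>i\<close>: one side is lowered
        there, the other is not.\<close>
      then have "y ! i - 1 = y ! i"
        using arg_cong[OF upd, of "\<lambda>l. l ! i"] yz iy len by simp
      with iy show False by simp
    qed
    with yz show "i = j \<and> y = z" by simp
  qed
  ultimately have "horadam_e a b n = card ?P"
    by (simp add: horadam_e_def card_image)
  then show ?thesis by (simp add: finite_horadam_strings)
qed

text \<open>Only the first letter of \<open>v\<close> has its condition affected by the cut. It must
  be below \<open>a\<close> on both sides: in \<open>v\<close> alone it has no predecessor, and in
  \<open>w @ v\<close> its predecessor is nonzero.\<close>

lemma horadam_strings_append_iff:
  assumes "length w = Suc i" "w ! i \<noteq> 0"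
  shows "w @ v \<in> horadam_strings a b (Suc i + m) \<longleftrightarrow>
    w \<in> horadam_strings a b (Suc i) \<and> v \<in> horadam_strings a b m"
    (is "?L \<longleftrightarrow> ?R")
proof
  assume L: ?L
  then have len: "length v = m" and sub: "set w \<subseteq> {0..<a + b}" "set v \<subseteq> {0..<a + b}"
    and ok: "\<And>j. j < Suc i + m \<Longrightarrow> a \<le> (w @ v) ! j \<Longrightarrow> 0 < j \<and> (w @ v) ! (j - 1) = 0"
    using assms by (auto simp: horadam_strings_def)
  have "0 < j \<and> w ! (j - 1) = 0" if "j < Suc i" "a \<le> w ! j" for j
    using ok[of j] that assms by (auto simp: nth_append split: if_splits)
  moreover have "0 < j \<and> v ! (j - 1) = 0" if "j < m" "a \<le> v ! j" for j
    using ok[of "Suc i + j"] that assms by (cases j) (auto simp: nth_append)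
  ultimately show ?R using assms len sub by (auto simp: horadam_strings_def)
next
  assume R: ?R
  then have len: "length v = m" and sub: "set w \<subseteq> {0..<a + b}" "set v \<subseteq> {0..<a + b}"
    and okw: "\<And>j. j < Suc i \<Longrightarrow> a \<le> w ! j \<Longrightarrow> 0 < j \<and> w ! (j - 1) = 0"
    and okv: "\<And>j. j < m \<Longrightarrow> a \<le> v ! j \<Longrightarrow> 0 < j \<and> v ! (j - 1) = 0"
    by (auto simp: horadam_strings_def)
  have "0 < j \<and> (w @ v) ! (j - 1) = 0" if j: "j < Suc i + m" "a \<le> (w @ v) ! j" for j
  proof (cases "j < Suc i")
    case True
    then show ?thesis using okw[of j] j assms by (auto simp: nth_append)
  next
    case False
    then obtain k where k: "j = Suc i + k" using le_Suc_ex by (metis not_less)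
    then show ?thesis using okv[of k] j assms by (auto simp: nth_append)
  qed
  then show ?L using assms len sub by (auto simp: horadam_strings_def)
qed

text \<open>Since \<open>a\<close> is positive, the letter 0 may follow anything, so appending it
  adds no condition.\<close>

lemma horadam_strings_snoc_zero_iff:
  assumes "1 \<le> a"
  shows "w @ [0] \<in> horadam_strings a b (Suc i) \<longleftrightarrow> w \<in> horadam_strings a b i"
proof -
  have "(\<forall>j<Suc i. a \<le> (w @ [0]) ! j \<longrightarrow> 0 < j \<and> (w @ [0]) ! (j - 1) = 0) \<longleftrightarrow>
      (\<forall>j<i. a \<le> w ! j \<longrightarrow> 0 < j \<and> w ! (j - 1) = 0)" if "length w = i"
    using that assms by (auto simp: nth_append less_Suc_eq)
  then show ?thesis using assms by (auto simp: horadam_strings_def)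
qed

text \<open>Counts by complement. The integer form keeps the difference from being
  truncated.\<close>

lemma card_horadam_strings_last_nonzero:
  assumes "1 \<le> a"
  shows "int (card {w \<in> horadam_strings a b (Suc i). w ! i \<noteq> 0}) =
    int (horadam_s a b (Suc i)) - int (horadam_s a b i)"
proof -
  let ?S = "horadam_strings a b (Suc i)"
  have "{w \<in> ?S. w ! i = 0} = (\<lambda>w. w @ [0]) ` horadam_strings a b i"
  proof (intro equalityI subsetI)
    fix w assume w: "w \<in> {w \<in> ?S. w ! i = 0}"
    then have "length w = Suc i" by (simp add: horadam_strings_def)
    then have eq: "w = take i w @ [0]"
      using w take_Suc_conv_app_nth[of i w] by simp
    then have "take i w \<in> horadam_strings a b i"
      using w horadam_strings_snoc_zero_iff[OF assms] by (metis (lifting) mem_Collect_eq)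
    with eq show "w \<in> (\<lambda>w. w @ [0]) ` horadam_strings a b i" by blast
  next
    fix w assume "w \<in> (\<lambda>w. w @ [0]) ` horadam_strings a b i"
    then obtain u where w: "w = u @ [0]" and u: "u \<in> horadam_strings a b i" by blast
    then have "length u = i" by (simp add: horadam_strings_def)
    with u show "w \<in> {w \<in> ?S. w ! i = 0}"
      by (auto simp: w horadam_strings_snoc_zero_iff[OF assms] nth_append)
  qed
  then have "card {w \<in> ?S. w ! i = 0} = horadam_s a b i"
    by (simp add: horadam_s_def card_image inj_on_def)
  moreover have "card ?S = card {w \<in> ?S. w ! i = 0} + card {w \<in> ?S. w ! i \<noteq> 0}"
    by (subst card_Un_disjoint[symmetric])
      (auto simp: finite_horadam_strings intro: arg_cong[where f = card])
  ultimately show ?thesis by (simp add: horadam_s_def)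
qed

lemma card_horadam_strings_nth_nonzero:
  assumes "i < n"
  shows "card {y \<in> horadam_strings a b n. y ! i \<noteq> 0} =
    card {w \<in> horadam_strings a b (Suc i). w ! i \<noteq> 0} * horadam_s a b (n - Suc i)"
proof -
  let ?A = "{w \<in> horadam_strings a b (Suc i). w ! i \<noteq> 0}"
  let ?V = "horadam_strings a b (n - Suc i)"
  have n: "n = Suc i + (n - Suc i)" using assms by simp
  have lenA: "length w = Suc i" if "w \<in> ?A" for w
    using that by (simp add: horadam_strings_def)
  have "{y \<in> horadam_strings a b n. y ! i \<noteq> 0} = (\<lambda>(w, v). w @ v) ` (?A \<times> ?V)"
  proof (intro equalityI subsetI)
    fix y assume y: "y \<in> {y \<in> horadam_strings a b n. y ! i \<noteq> 0}"
    let ?w = "take (Suc i) y" and ?v = "drop (Suc i) y"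
    have len: "length ?w = Suc i" and nz: "?w ! i \<noteq> 0"
      using y assms by (auto simp: horadam_strings_def)
    have "?w @ ?v \<in> horadam_strings a b (Suc i + (n - Suc i))"
      using y n by simp
    then have "(?w, ?v) \<in> ?A \<times> ?V"
      using horadam_strings_append_iff[OF len nz] nz by blast
    then show "y \<in> (\<lambda>(w, v). w @ v) ` (?A \<times> ?V)"
      by (rule rev_image_eqI) simp
  next
    fix y assume "y \<in> (\<lambda>(w, v). w @ v) ` (?A \<times> ?V)"
    then obtain w v where y: "y = w @ v" and w: "w \<in> ?A" and v: "v \<in> ?V" by auto
    have "w @ v \<in> horadam_strings a b (Suc i + (n - Suc i))"
      using horadam_strings_append_iff[of w i] lenA w v by blast
    then show "y \<in> {y \<in> horadam_strings a b n. y ! i \<noteq> 0}"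
      using y w lenA[OF w] n by (simp add: nth_append)
  qed
  \<comment> \<open>All first parts have length \<open>Suc i\<close>, so a concatenation determines
    both of its factors.\<close>
  moreover have "inj_on (\<lambda>(w, v). w @ v) (?A \<times> ?V)"
    by (rule inj_onI) (auto dest!: lenA simp: horadam_strings_def)
  ultimately show ?thesis
    by (simp add: card_image card_cartesian_product horadam_s_def)
qed

theorem theorem4:
  fixes a b n :: nat
  assumes "1 \<le> a" and "1 \<le> b"
  shows "int (horadam_e a b n) =
    (\<Sum>k<n. int (horadam_s a b k) *
      (int (horadam_s a b (n - k)) - int (horadam_s a b (n - 1 - k))))"
proof -
  let ?g = "\<lambda>i. int (horadam_s a b (n - Suc i)) *
      (int (horadam_s a b (Suc i)) - int (horadam_s a b i))"
  have "int (horadam_e a b n) = (\<Sum>i<n. ?g i)"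
    unfolding horadam_e_eq_sum_nonzero of_nat_sum
  proof (rule sum.cong[OF refl])
    fix i assume "i \<in> {..<n}"
    then have "i < n" by simp
    show "int (card {y \<in> horadam_strings a b n. y ! i \<noteq> 0}) = ?g i"
      unfolding card_horadam_strings_nth_nonzero[OF \<open>i < n\<close>] of_nat_mult
        card_horadam_strings_last_nonzero[OF assms(1)] by (rule mult.commute)
  qed
  \<comment> \<open>Reverses the order of summation: \<open>k\<close> is now the length of the part
    after the cut, while \<open>i\<close> was the position of the lowered letter.\<close>
  also have "\<dots> = (\<Sum>k<n. ?g (n - Suc k))"
    by (rule sum.nat_diff_reindex[symmetric])
  also have "\<dots> = (\<Sum>k<n. int (horadam_s a b k) *
      (int (horadam_s a b (n - k)) - int (horadam_s a b (n - 1 - k))))"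
  proof (rule sum.cong[OF refl])
    fix k assume "k \<in> {..<n}"
    \<comment> \<open>These natural subtractions are exact because \<open>k\<close> is less than
      \<open>n\<close>.\<close>
    then have "n - Suc (n - Suc k) = k" "Suc (n - Suc k) = n - k" "n - Suc k = n - 1 - k"
      by auto
    then show "?g (n - Suc k) = int (horadam_s a b k) *
        (int (horadam_s a b (n - k)) - int (horadam_s a b (n - 1 - k)))"
      by metis
  qed
  finally show ?thesis .
qed

end
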